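(* Let $q\geq 2$ and $d\geq 2$ be integers, and let $a,j$ be integers with $0\leq a<d$ and $0\leq j<q$. For $N\geq 1$ define $$g(N)=\#\{\,0\leq n<N:\ n\equiv a \pmod d,\ s_q(n)\equiv j \pmod q\,\}-\frac{N}{dq}.$$ Then: (i) If $d\mid q$, then $g(N)=O(1)$ (i.e. $|g(N)|$ is bounded by a constant independent of $N$), and $g(N)$ changes sign infinitely often as $N\to\infty$; that is, $g(N)>0$ for infinitely many $N$ and $g(N)<0$ for infinitely many $N$. (ii) If $d\mid q-1$, then $g(N)$ takes arbitrarily large positive values as well as arbitrarily large negative values as $N\to\infty$; that is, $\limsup_{N\to\infty} g(N)=+\infty$ and $\liminf_{N\to\infty} g(N)=-\infty$.
   Context: For an integer $q\geq 2$, $s_q:\mathbb{N}\to\mathbb{N}$ denotes the sum-of-digits function in base $q$: if $n=\sum_{i=0}^k \varepsilon_i q^i$ with digits $\varepsilon_i\in\{0,1,\dots,q-1\}$, then $s_q(n)=\sum_{i=0}^k\varepsilon_i$. *)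

theory Defs
  imports Complex_Main "HOL-Library.Extended_Real" "HOL-Library.Liminf_Limsup" "HOL-Number_Theory.Cong"
begin

text \<open>
  The guard \<open>q < 2\<close> only ensures termination. For \<open>q \<ge> 2\<close> the lemma \<open>digit_sum_digits\<close> below
  identifies the value with the sum of the digits of any base \<open>q\<close> expansion.
\<close>

function digit_sum :: "nat \<Rightarrow> nat \<Rightarrow> nat" where
  "digit_sum q n = (if q < 2 \<or> n = 0 then 0 else n mod q + digit_sum q (n div q))"
  by auto
termination by (relation "measure snd") auto

declare digit_sum.simps [simp del]

lemma digit_sum_rec: "q \<ge> 2 \<Longrightarrow> digit_sum q n = n mod q + digit_sum q (n div q)"
  by (cases "n = 0") (simp_all add: digit_sum.simps)

lemma digit_sum_digits:
  fixes q k :: nat and \<epsilon> :: "nat \<Rightarrow> nat"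
  assumes "q \<ge> 2" and "\<And>i. i \<le> k \<Longrightarrow> \<epsilon> i < q"
  shows "digit_sum q (\<Sum>i\<le>k. \<epsilon> i * q ^ i) = (\<Sum>i\<le>k. \<epsilon> i)"
  using assms(2)
proof (induction k arbitrary: \<epsilon>)
  case 0
  then show ?case using assms(1) by (subst digit_sum_rec) (simp_all add: digit_sum.simps)
next
  case (Suc k)
  let ?m = "\<Sum>i\<le>k. \<epsilon> (Suc i) * q ^ i"
  have "(\<Sum>i\<le>Suc k. \<epsilon> i * q ^ i) = \<epsilon> 0 + q * ?m"
    by (simp only: sum.atMost_Suc_shift) (simp add: sum_distrib_left mult_ac)
  moreover have "digit_sum q (\<epsilon> 0 + q * ?m) = \<epsilon> 0 + digit_sum q ?m"
    using Suc.prems[of 0] assms(1) by (subst digit_sum_rec) simp_all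
  moreover have "digit_sum q ?m = (\<Sum>i\<le>k. \<epsilon> (Suc i))"
    by (rule Suc.IH) (simp add: Suc.prems)
  ultimately show ?case by (simp only: sum.atMost_Suc_shift)
qed

definition discrepancy :: "nat \<Rightarrow> nat \<Rightarrow> nat \<Rightarrow> nat \<Rightarrow> nat \<Rightarrow> real" where
  "discrepancy q d a j N =
     real (card {n. n < N \<and> [n = a] (mod d) \<and> [digit_sum q n = j] (mod q)})
       - real N / (real d * real q)"

end

theory Submission
  imports Defs "HOL-Library.Real_Mod"
begin

text \<open>
  If \<open>d\<close> divides \<open>q\<close>, the residue of \<open>n\<close> modulo \<open>d\<close> only depends on the last digit of \<open>n\<close>.
  Fixing all digits but the last, and then all digits but the last two, shows that blocks of
  \<open>q\<^sup>2\<close> consecutive integers contribute nothing, while the first \<open>q\<close> integers of such a block contribute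
  \<open>1 - 1/d\<close> or \<open>-1/d\<close>, depending on the digit sum of the remaining digits.

  If \<open>d\<close> divides \<open>q - 1\<close>, then \<open>n\<close> is congruent to its digit sum modulo \<open>d\<close>, so by the Chinese remainder
  theorem one counts the \<open>n\<close> whose digit sum lies in a residue class \<open>b\<close> modulo \<open>m = d q\<close>. For
  \<open>N = q ^ k\<close>, Fourier inversion on the integers modulo \<open>m\<close> writes this count as \<open>1/m\<close> times the sum over
  \<open>l < m\<close> of \<open>D(x) ^ k cos ((k (q - 1) - 2 b) x)\<close> with \<open>x = \<pi> l / m\<close> and
  \<open>D(x) = sin (q x) / sin x\<close>. The term \<open>l = 0\<close> is the expected value; among the others the two equal
  terms \<open>l = 1\<close> and \<open>l = m - 1\<close> strictly dominate and grow exponentially. Their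
  sign is that of a cosine whose phase advances by less than a quarter turn with each step of \<open>k\<close>, so both
  signs occur, each along a whole arithmetic progression of exponents.
\<close>

section \<open>Sums over digits\<close>

lemma digit_sum_0 [simp]: "digit_sum q 0 = 0"
  by (simp add: digit_sum.simps)

lemma digit_sum_append_digit:
  assumes "c < q" "q \<ge> 2"
  shows "digit_sum q (q * n + c) = digit_sum q n + c"
  using assms by (subst digit_sum_rec) auto

lemma digit_sum_mult_power:
  assumes "q \<ge> 2"
  shows "digit_sum q (q ^ i * n) = digit_sum q n"
  using digit_sum_append_digit[of 0 q] assms by (induction i) (simp_all add: mult.assoc)

lemma digit_sum_surj:
  assumes "q \<ge> 2"
  shows "\<exists>n. digit_sum q n = c"
proof (induction c)
  case 0
  show ?case by (rule exI[of _ 0]) simp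
next
  case (Suc c)
  then obtain n where "digit_sum q n = c" by blast
  then have "digit_sum q (q * n + 1) = Suc c"
    using assms digit_sum_append_digit[of 1 q n] by simp
  then show ?case by blast
qed

text \<open>Since \<open>q\<close> is 1 modulo \<open>d\<close>, dropping the factor
  \<open>q\<close> from \<open>q * (n div q)\<close> keeps the residue.\<close>

lemma cong_digit_sum:
  assumes "q \<ge> 2" "d dvd q - 1"
  shows "[digit_sum q n = n] (mod d)"
proof (induction n rule: less_induct)
  case (less n)
  show ?case
  proof (cases "n = 0")
    case False
    obtain e where e: "q = d * e + 1"
      using assms by (metis dvdE le_add_diff_inverse2 one_le_numeral order_trans)
    have "[digit_sum q (n div q) = n div q] (mod d)"
      using False assms by (intro less) auto
    also have "q * (n div q) = d * (e * (n div q)) + n div q"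
      by (simp only: e) (simp add: algebra_simps)
    then have "[n div q = q * (n div q)] (mod d)"
      by (simp only: cong_def mod_mult_self4)
    finally have "[n mod q + digit_sum q (n div q) = n mod q + q * (n div q)] (mod d)"
      by (simp only: cong_add_lcancel_nat)
    then show ?thesis using digit_sum_rec[OF assms(1), of n] by simp
  qed simp
qed

text \<open>Used to sum over the last digit with the leading digits fixed.\<close>

lemma sum_mult_block:
  fixes f :: "nat \<Rightarrow> 'a::comm_monoid_add"
  shows "(\<Sum>n<q * k. f n) = (\<Sum>i<k. \<Sum>c<q. f (q * i + c))"
proof -
  have "(\<Sum>c<q. f (q * i + c)) = sum f {i * q..<i * q + q}" for i
    using sum.shift_bounds_nat_ivl[of f 0 "i * q" q]
    by (simp add: lessThan_atLeast0 add.commute mult.commute)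
  then show ?thesis
    using sum.nat_group[of f q k] by (simp add: mult.commute)
qed

lemma discrepancy_eq_sum:
  "discrepancy q d a j N =
     (\<Sum>n<N. of_bool ([n = a] (mod d) \<and> [digit_sum q n = j] (mod q)) - 1 / (real d * real q))"
  by (simp add: discrepancy_def sum_subtractf sum.If_cases of_bool_def Int_def)

lemma sum_of_bool_cong:
  fixes d u v :: nat
  assumes "d > 0"
  shows "(\<Sum>c<d. of_bool ([u + c = v] (mod d))) = (1::real)"
proof -
  \<comment> \<open>Adding \<open>d * u\<close> first keeps the subtraction of \<open>u\<close> from
    truncating at zero.\<close>
  define c where "c = (v + d * u - u) mod d"
  have "c < d" using assms unfolding c_def by (rule mod_less_divisor)
  have "u \<le> d * u" using assms by simp
  have "[u + c = u + (v + d * u - u)] (mod d)"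
    unfolding c_def by (simp add: cong_def mod_simps)
  also have "u + (v + d * u - u) = v + d * u" using \<open>u \<le> d * u\<close> by (simp only: le_add_diff_inverse trans_le_add2)
  also have "[v + d * u = v] (mod d)" by (simp add: cong_def)
  finally have c: "[u + c = v] (mod d)" .
  have "[u + x = v] (mod d) \<longleftrightarrow> x = c" if "x < d" for x
  proof -
    have "[u + x = v] (mod d) \<longleftrightarrow> [u + x = u + c] (mod d)"
      using c by (simp add: cong_def)
    also have "\<dots> \<longleftrightarrow> x = c"
      unfolding cong_add_lcancel_nat using that \<open>c < d\<close> by (simp add: cong_def)
    finally show ?thesis .
  qed
  then have "(\<Sum>c<d. of_bool ([u + c = v] (mod d))) = (\<Sum>x<d. if x = c then 1 else 0 :: real)"
    by (intro sum.cong) auto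
  then show ?thesis using \<open>c < d\<close> by simp
qed

lemma sum_of_bool_cong_dvd:
  fixes d q u v :: nat
  assumes "d > 0" "d dvd q"
  shows "(\<Sum>c<q. of_bool ([u + c = v] (mod d))) = real q / real d"
proof -
  obtain e where e: "q = d * e" using assms by blast
  have "[u + (d * i + c) = v] (mod d) \<longleftrightarrow> [u + c = v] (mod d)" for i c
    by (simp only: cong_def add.left_commute[of u] mod_mult_self4)
  then show ?thesis
    unfolding e sum_mult_block using assms by (simp add: sum_of_bool_cong del: sum_of_bool_eq)
qed

section \<open>Divisors of the base\<close>

context
  fixes q d a j :: nat
  assumes q: "q \<ge> 2" and d: "d > 0" and dvd: "d dvd q"
begin

text \<open>For fixed leading digits \<open>i\<close>, exactly one last digit \<open>c\<close>
  satisfies the condition modulo \<open>q\<close>. As \<open>d\<close> divides \<open>q\<close>, it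
  also fixes \<open>c\<close> modulo \<open>d\<close>, so \<open>[n = a] (mod d)\<close> becomes a
  condition on \<open>i\<close> alone.\<close>

lemma discrepancy_mult_base:
  "discrepancy q d a j (q * k) = (\<Sum>i<k. of_bool ([digit_sum q i + a = j] (mod d)) - 1 / real d)"
proof -
  have "(\<Sum>c<q. of_bool ([q * i + c = a] (mod d) \<and> [digit_sum q (q * i + c) = j] (mod q))
           - 1 / (real d * real q)) = of_bool ([digit_sum q i + a = j] (mod d)) - 1 / real d" for i
  proof -
    have "[q * i + c = a] (mod d) \<and> [digit_sum q (q * i + c) = j] (mod q) \<longleftrightarrow>
          [digit_sum q i + a = j] (mod d) \<and> [digit_sum q i + c = j] (mod q)" if "c < q" for c
    proof (cases "[digit_sum q i + c = j] (mod q)")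
      case True
      have "[q * i + c = c] (mod d)"
        using dvd by (auto simp only: cong_def dvd_def mult.assoc mod_mult_self4)
      then have "[q * i + c = a] (mod d) \<longleftrightarrow> [c = a] (mod d)"
        by (metis cong_def)
      also have "\<dots> \<longleftrightarrow> [digit_sum q i + c = digit_sum q i + a] (mod d)"
        by (simp add: cong_add_lcancel_nat)
      also have "\<dots> \<longleftrightarrow> [digit_sum q i + a = j] (mod d)"
        using cong_dvd_modulus_nat[OF True dvd] by (auto simp: cong_def)
      finally show ?thesis using True that q by (simp add: digit_sum_append_digit)
    qed (use that q in \<open>simp add: digit_sum_append_digit\<close>)
    then have "(\<Sum>c<q. of_bool ([q * i + c = a] (mod d) \<and> [digit_sum q (q * i + c) = j] (mod q))) =
        (\<Sum>c<q. of_bool ([digit_sum q i + a = j] (mod d)) *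
                 of_bool ([digit_sum q i + c = j] (mod q)) :: real)"
      by (intro sum.cong) (auto simp del: of_bool_eq_iff)
    also have "\<dots> = of_bool ([digit_sum q i + a = j] (mod d))"
      using q sum_of_bool_cong[of q "digit_sum q i" j] by (simp flip: sum_distrib_left)
    finally show ?thesis using q by (simp add: sum_subtractf)
  qed
  then show ?thesis by (simp add: discrepancy_eq_sum sum_mult_block)
qed

text \<open>The second-to-last digit meets each residue modulo \<open>d\<close> exactly
  \<open>q / d\<close> times, which cancels \<open>q\<close> copies of \<open>1 / d\<close>.\<close>

lemma discrepancy_mult_base_square: "discrepancy q d a j (q * (q * M)) = 0"
proof -
  have "(\<Sum>c<q. of_bool ([digit_sum q (q * i + c) + a = j] (mod d)) - 1 / real d) = 0" for i
  proof -
    have "digit_sum q (q * i + c) + a = (digit_sum q i + a) + c" if "c < q" for c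
      using q that by (simp add: digit_sum_append_digit)
    then have "(\<Sum>c<q. of_bool ([digit_sum q (q * i + c) + a = j] (mod d))) =
          (\<Sum>c<q. of_bool ([(digit_sum q i + a) + c = j] (mod d)) :: real)"
      by (intro sum.cong) (simp_all only: lessThan_iff)
    then show ?thesis
      using d dvd by (simp add: sum_subtractf sum_of_bool_cong_dvd del: sum_of_bool_eq)
  qed
  then show ?thesis
    unfolding discrepancy_mult_base sum_mult_block by simp
qed

lemma discrepancy_mult_base_square_plus_base:
  "discrepancy q d a j (q * (q * M + 1)) =
     of_bool ([digit_sum q M + a = j] (mod d)) - 1 / real d"
proof -
  have "digit_sum q (q * M) = digit_sum q M"
    using digit_sum_append_digit[of 0 q M] q by simp
  then show ?thesis
    using discrepancy_mult_base_square[of M]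
    unfolding discrepancy_mult_base by simp
qed

lemma discrepancy_bounded: "\<bar>discrepancy q d a j N\<bar> \<le> real (q * q)"
proof -
  define w :: "nat \<Rightarrow> real" where
    "w n = of_bool ([n = a] (mod d) \<and> [digit_sum q n = j] (mod q)) - 1 / (real d * real q)" for n
  have D: "discrepancy q d a j N = sum w {..<N}" for N
    by (simp add: discrepancy_eq_sum w_def)
  have "1 / (real d * real q) \<le> 1" using d q
    by (simp add: divide_le_eq) (metis One_nat_def Suc_leI add_gr_0 less_le_trans mult_pos_pos
        of_nat_1 of_nat_le_iff of_nat_mult pos2)
  then have w: "\<bar>w n\<bar> \<le> 1" for n
    by (auto simp: w_def of_bool_def)
  \<comment> \<open>Cutting at the last multiple of \<open>q * q\<close> up to \<open>N\<close>
    leaves at most \<open>q * q\<close> terms, each of size at most 1.\<close>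
  define M where "M = N div (q * q)"
  have N: "q * q * M \<le> N" "N - q * q * M \<le> q * q"
    using q by (simp_all add: M_def minus_mult_div_eq_mod less_imp_le)
  then have "{..<N} = {..<q * q * M} \<union> {q * q * M..<N}" by auto
  then have "sum w {..<N} = sum w {..<q * q * M} + sum w {q * q * M..<N}"
    by (simp add: sum.union_disjoint ivl_disj_int)
  also have "sum w {..<q * q * M} = 0"
    using discrepancy_mult_base_square[of M] by (simp add: D mult.assoc)
  finally have "\<bar>discrepancy q d a j N\<bar> \<le> (\<Sum>n\<in>{q * q * M..<N}. \<bar>w n\<bar>)"
    by (simp add: D sum_abs)
  also have "\<dots> \<le> (\<Sum>n\<in>{q * q * M..<N}. 1)" by (intro sum_mono w)
  also have "\<dots> \<le> real (q * q)" using N(2) by (simp only: sum_constant card_atLeastLessThan mult_1_right of_nat_le_iff)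
  finally show ?thesis .
qed

lemma infinite_discrepancy_value:
  assumes "c > 0"
  shows "infinite {N. N \<ge> 1 \<and> discrepancy q d a j N = of_bool ([c + a = j] (mod d)) - 1 / real d}"
  unfolding infinite_nat_iff_unbounded
proof
  fix m
  obtain M where M: "digit_sum q M = c" using digit_sum_surj q by blast
  then have "M > 0" using assms by (cases "M = 0") auto
  \<comment> \<open>The factor \<open>q ^ m\<close> appends zeros: it pushes \<open>n\<close> beyond
    \<open>m\<close> without changing the digit sum.\<close>
  define n where "n = q * (q * (q ^ m * M) + 1)"
  have "m < q ^ m" using q by (intro power_gt_expt) simp
  also have "\<dots> \<le> q ^ m * M" using \<open>M > 0\<close> by simp
  also have "\<dots> \<le> q * (q * (q ^ m * M))" using q by simp
  also have "\<dots> \<le> n" by (simp add: n_def)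
  finally have "m < n" .
  moreover have "discrepancy q d a j n = of_bool ([c + a = j] (mod d)) - 1 / real d"
    unfolding n_def discrepancy_mult_base_square_plus_base
    using q M by (simp add: digit_sum_mult_power)
  ultimately show "\<exists>n>m. n \<in> {N. N \<ge> 1 \<and>
      discrepancy q d a j N = of_bool ([c + a = j] (mod d)) - 1 / real d}"
    by (intro exI[of _ n]) auto
qed

lemma infinite_discrepancy_sign:
  assumes "d \<ge> 2" "a < d"
  shows "infinite {N. N \<ge> 1 \<and> discrepancy q d a j N > 0}"
    and "infinite {N. N \<ge> 1 \<and> discrepancy q d a j N < 0}"
proof -
  \<comment> \<open>The digit sum \<open>j + (d - a)\<close> stands for \<open>j - a\<close> modulo
    \<open>d\<close> and gives the value \<open>1 - 1/d\<close>; one more misses the class and gives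
    \<open>-1/d\<close>.\<close>
  have eq: "j + (d - a) + a = j + d" "j + (d - a) + 1 + a = (j + 1) + d"
    using assms by simp_all
  have "[j + (d - a) + a = j] (mod d)" unfolding eq by (simp add: cong_def)
  then show "infinite {N. N \<ge> 1 \<and> discrepancy q d a j N > 0}"
    using assms by (intro infinite_super[OF _ infinite_discrepancy_value[of "j + (d - a)"]]) auto
  have "\<not> [j + 1 = j + 0] (mod d)"
    unfolding cong_add_lcancel_nat using assms by (simp add: cong_def)
  then have "\<not> [j + (d - a) + 1 + a = j] (mod d)" unfolding eq by (simp add: cong_def del: add_Suc_right add_Suc One_nat_def)
  then show "infinite {N. N \<ge> 1 \<and> discrepancy q d a j N < 0}"
    using assms by (intro infinite_super[OF _ infinite_discrepancy_value[of "j + (d - a) + 1"]]) auto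
qed

end

section \<open>Fourier expansion of the count by digit sum\<close>

text \<open>The \<open>k\<close> digits range independently, so the generating function
  factors.\<close>

lemma sum_power_digit_sum:
  fixes z :: "'a::comm_semiring_1"
  assumes "q \<ge> 2"
  shows "(\<Sum>n<q ^ k. z ^ digit_sum q n) = (\<Sum>c<q. z ^ c) ^ k"
proof (induction k)
  case (Suc k)
  have "(\<Sum>n<q ^ Suc k. z ^ digit_sum q n) = (\<Sum>i<q ^ k. \<Sum>c<q. z ^ digit_sum q i * z ^ c)"
    unfolding power_Suc sum_mult_block
    using assms by (intro sum.cong) (simp_all add: digit_sum_append_digit power_add)
  also have "\<dots> = (\<Sum>i<q ^ k. z ^ digit_sum q i) * (\<Sum>c<q. z ^ c)"
    by (simp add: sum_product)
  finally show ?case by (simp add: Suc.IH mult.commute)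
qed simp

lemma sum_roots_of_unity_orthogonal:
  assumes "m > 0"
  shows "(\<Sum>l<m. cis (2 * (pi * real l / real m)) ^ s * cnj (cis (2 * (pi * real l / real m)) ^ b)) =
           of_nat m * of_bool ([s = b] (mod m))"
proof -
  \<comment> \<open>The sum over \<open>l\<close> is geometric in \<open>w\<close>, an
    \<open>m\<close>-th root of unity equal to 1 exactly when \<open>s\<close> and \<open>b\<close>
    agree modulo \<open>m\<close>.\<close>
  define w where "w = cis (2 * pi * (real s - real b) / real m)"
  have term_eq: "cis (2 * (pi * real l / real m)) ^ s * cnj (cis (2 * (pi * real l / real m)) ^ b) = w ^ l"
    for l
    by (simp add: w_def DeMoivre cis_cnj cis_mult algebra_simps diff_divide_distrib)
  have "2 * pi * (real s - real b) / real m = of_int n * (2 * pi) \<longleftrightarrow>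
        real_of_int (int s - int b) = real_of_int (n * int m)" for n
  proof -
    have "2 * pi * (real s - real b) / real m = of_int n * (2 * pi) \<longleftrightarrow>
          (2 * pi) * ((real s - real b) / real m) = (2 * pi) * of_int n"
      by (simp add: mult.commute)
    also have "\<dots> \<longleftrightarrow> (real s - real b) / real m = of_int n"
      by (subst mult_cancel_left) simp
    finally show ?thesis using assms by (simp add: field_simps)
  qed
  then have "w = 1 \<longleftrightarrow> (\<exists>n::int. real_of_int (int s - int b) = real_of_int (n * int m))"
    by (simp only: w_def cis_eq_1_iff)
  also have "\<dots> \<longleftrightarrow> [s = b] (mod m)"
    unfolding of_int_eq_iff cong_int_iff[symmetric] cong_iff_dvd_diff by (auto simp: dvd_def mult.commute)
  finally have w1: "w = 1 \<longleftrightarrow> [s = b] (mod m)" .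
  have "w ^ m = cis (2 * pi * real_of_int (int s - int b))"
    using assms by (simp add: w_def DeMoivre)
  also have "\<dots> = 1" by (intro cis_multiple_2pi) simp
  finally have "w ^ m = 1" .
  then show ?thesis
    unfolding term_eq using w1 by (cases "w = 1") (simp_all add: geometric_sum)
qed

text \<open>Up to the normalising factor \<open>1/m\<close>, the contribution of the frequency \<open>x = \<pi> l / m\<close> to the number
  of \<open>n < q ^ k\<close> with digit sum congruent to \<open>b\<close> modulo \<open>m\<close>.\<close>

definition digit_sum_mode :: "nat \<Rightarrow> nat \<Rightarrow> nat \<Rightarrow> real \<Rightarrow> real" where
  "digit_sum_mode q b k x = Re (cnj (cis (2 * x) ^ b) * (\<Sum>c<q. cis (2 * x) ^ c) ^ k)"

lemma card_digit_sum_cong: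
  assumes "q \<ge> 2" "m > 0"
  shows "real m * real (card {n. n < q ^ k \<and> [digit_sum q n = b] (mod m)}) =
           (\<Sum>l<m. digit_sum_mode q b k (pi * real l / real m))"
proof -
  let ?z = "\<lambda>l. cis (2 * (pi * real l / real m))"
  have "complex_of_real (real m * real (card {n. n < q ^ k \<and> [digit_sum q n = b] (mod m)})) =
        (\<Sum>n<q ^ k. of_nat m * of_bool ([digit_sum q n = b] (mod m)))"
    by (simp add: Int_def flip: sum_distrib_left)
  also have "\<dots> = (\<Sum>n<q ^ k. \<Sum>l<m. ?z l ^ digit_sum q n * cnj (?z l ^ b))"
    using assms by (simp only: sum_roots_of_unity_orthogonal)
  also have "\<dots> = (\<Sum>l<m. cnj (?z l ^ b) * (\<Sum>n<q ^ k. ?z l ^ digit_sum q n))"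
    by (subst sum.swap) (simp add: sum_distrib_left mult.commute)
  also have "\<dots> = (\<Sum>l<m. cnj (?z l ^ b) * (\<Sum>c<q. ?z l ^ c) ^ k)"
    using assms by (simp only: sum_power_digit_sum)
  finally show ?thesis
    unfolding digit_sum_mode_def Re_sum[symmetric] by (metis Re_complex_of_real)
qed

lemma digit_sum_mode_0: "digit_sum_mode q b k 0 = real q ^ k"
  by (simp add: digit_sum_mode_def flip: of_nat_power)

lemma cis_double_reflect: "cis (2 * (pi - x)) = cnj (cis (2 * x))"
proof -
  have "cis (2 * (pi - x)) = cis (2 * pi) * cis (- (2 * x))"
    unfolding cis_mult by (simp add: algebra_simps)
  then show ?thesis by (simp add: cis_cnj)
qed

text \<open>Reflection conjugates the complex expression and so preserves its real part. This pairs
  the frequencies \<open>l\<close> and \<open>m - l\<close>.\<close>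

lemma digit_sum_mode_reflect: "digit_sum_mode q b k (pi - x) = digit_sum_mode q b k x"
proof -
  have "cnj (cis (2 * (pi - x)) ^ b) * (\<Sum>c<q. cis (2 * (pi - x)) ^ c) ^ k =
             cnj (cnj (cis (2 * x) ^ b) * (\<Sum>c<q. cis (2 * x) ^ c) ^ k)"
    unfolding cis_double_reflect by simp
  then show ?thesis by (simp only: digit_sum_mode_def complex_cnj cnj.simps)
qed

text \<open>This is \<open>sin (q * x) / sin x\<close>, written as a cosine sum so that it is also
  meaningful at zeros of \<open>sin x\<close>.\<close>

definition dirichlet_kernel :: "nat \<Rightarrow> real \<Rightarrow> real" where
  "dirichlet_kernel q x = (\<Sum>c<q. cos ((real q - 1 - 2 * real c) * x))"

text \<open>Factoring out the mean exponent leaves angles symmetric under \<open>c\<close> to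
  \<open>q - 1 - c\<close>, so their sines cancel and a real sum remains.\<close>

lemma sum_cis_power_eq_dirichlet_kernel:
  "(\<Sum>c<q. cis (2 * x) ^ c) = cis ((real q - 1) * x) * complex_of_real (dirichlet_kernel q x)"
proof -
  define f where "f c = (real q - 1 - 2 * real c) * x" for c
  have f_reflect: "f (q - Suc c) = - f c" if "c < q" for c
    using that by (simp add: f_def of_nat_diff algebra_simps)
  have "(\<Sum>c<q. sin (f c)) = (\<Sum>c<q. sin (f (q - Suc c)))"
    by (rule sum.nat_diff_reindex[symmetric])
  also have "\<dots> = (\<Sum>c<q. - sin (f c))"
    by (intro sum.cong) (simp_all add: f_reflect)
  finally have "(\<Sum>c<q. sin (f c)) = 0" by (simp add: sum_negf)
  then have "(\<Sum>c<q. cis (- f c)) = complex_of_real (dirichlet_kernel q x)"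
    by (simp add: complex_eq_iff dirichlet_kernel_def f_def sum_negf)
  moreover have "cis (2 * x) ^ c = cis ((real q - 1) * x) * cis (- f c)" for c
    by (simp add: DeMoivre cis_mult f_def algebra_simps)
  ultimately show ?thesis by (simp flip: sum_distrib_left)
qed

lemma digit_sum_mode_eq:
  "digit_sum_mode q b k x =
     dirichlet_kernel q x ^ k * cos ((real k * (real q - 1) - 2 * real b) * x)"
proof -
  have "cnj (cis (2 * x) ^ b) * (\<Sum>c<q. cis (2 * x) ^ c) ^ k =
        cis (- (real b * (2 * x))) * cis (real k * ((real q - 1) * x)) *
          complex_of_real (dirichlet_kernel q x ^ k)"
    unfolding sum_cis_power_eq_dirichlet_kernel
    by (simp add: power_mult_distrib DeMoivre cis_cnj)
  also have "\<dots> = complex_of_real (dirichlet_kernel q x ^ k) *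
                    cis ((real k * (real q - 1) - 2 * real b) * x)"
    unfolding cis_mult by (simp add: algebra_simps)
  finally show ?thesis by (simp add: digit_sum_mode_def)
qed

text \<open>For even \<open>q\<close> the kernel itself changes sign under reflection; absolute
  values agree as norms of conjugate sums.\<close>

lemma abs_dirichlet_kernel_reflect:
  "\<bar>dirichlet_kernel q (pi - x)\<bar> = \<bar>dirichlet_kernel q x\<bar>"
proof -
  have norm: "norm (\<Sum>c<q. cis (2 * x) ^ c) = \<bar>dirichlet_kernel q x\<bar>" for x
    by (simp add: sum_cis_power_eq_dirichlet_kernel norm_mult)
  have "(\<Sum>c<q. cis (2 * (pi - x)) ^ c) = cnj (\<Sum>c<q. cis (2 * x) ^ c)"
    unfolding cis_double_reflect by simp
  then show ?thesis by (metis norm complex_mod_cnj)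
qed

text \<open>The product-to-sum formula makes the sum telescope.\<close>

lemma dirichlet_kernel_mult_sin: "dirichlet_kernel q x * sin x = sin (real q * x)"
proof -
  have "2 * (dirichlet_kernel q x * sin x) =
        (\<Sum>c<q. sin ((real q - 2 * real c) * x) - sin ((real q - 2 * real (Suc c)) * x))"
    unfolding dirichlet_kernel_def sum_distrib_left sum_distrib_right
  proof (intro sum.cong refl)
    fix c
    let ?y = "(real q - 1 - 2 * real c) * x"
    have "(real q - 2 * real c) * x = ?y + x" "(real q - 2 * real (Suc c)) * x = ?y - x"
      by (simp_all add: algebra_simps)
    then show "2 * (cos ?y * sin x) =
        sin ((real q - 2 * real c) * x) - sin ((real q - 2 * real (Suc c)) * x)"
      by (simp only: sin_add sin_diff)
  qed
  also have "\<dots> = 2 * sin (real q * x)"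
    using sum_lessThan_telescope'[of "\<lambda>c. sin ((real q - 2 * real c) * x)" q] by simp
  finally show ?thesis by simp
qed

text \<open>Up to \<open>pi / q\<close> every angle has absolute value at most \<open>pi\<close>,
  where cosine decreases; the term \<open>c = 0\<close> is strict.\<close>

lemma dirichlet_kernel_strict_antimono:
  assumes "q \<ge> 2" "0 \<le> x" "x < y" "y \<le> pi / real q"
  shows "dirichlet_kernel q y < dirichlet_kernel q x"
  unfolding dirichlet_kernel_def
proof (rule sum_strict_mono_ex1)
  have y: "real q * y \<le> pi" using assms by (simp add: field_simps)
  have cos_abs: "cos (r * t) = cos (\<bar>r\<bar> * t)" if "t \<ge> 0" for r t :: real
    using that by (metis abs_mult abs_of_nonneg cos_abs_real)
  show "\<forall>c\<in>{..<q}. cos ((real q - 1 - 2 * real c) * y) \<le> cos ((real q - 1 - 2 * real c) * x)"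
  proof
    fix c assume "c \<in> {..<q}"
    then have r: "\<bar>real q - 1 - 2 * real c\<bar> \<le> real q" by auto
    have "\<bar>real q - 1 - 2 * real c\<bar> * y \<le> real q * y"
      using r assms by (intro mult_right_mono) auto
    also note y
    finally show "cos ((real q - 1 - 2 * real c) * y) \<le> cos ((real q - 1 - 2 * real c) * x)"
      using assms by (subst (1 2) cos_abs) (auto intro!: cos_monotone_0_pi_le mult_left_mono)
  qed
  have "(real q - 1) * y \<le> real q * y" using assms by (intro mult_right_mono) auto
  also note y
  finally have "cos ((real q - 1) * y) < cos ((real q - 1) * x)"
    using assms by (intro cos_monotone_0_pi) auto
  then show "\<exists>c\<in>{..<q}. cos ((real q - 1 - 2 * real c) * y) < cos ((real q - 1 - 2 * real c) * x)"
    using assms by (intro bexI[of _ 0]) auto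
qed simp

text \<open>The bound is the kernel's value at the right endpoint, where \<open>sin (q * x)\<close>
  equals 1.\<close>

lemma inverse_sin_le_dirichlet_kernel:
  assumes "q \<ge> 2" "0 \<le> x" "x \<le> pi / (2 * real q)"
  shows "1 / sin (pi / (2 * real q)) \<le> dirichlet_kernel q x"
proof -
  let ?h = "pi / (2 * real q)"
  have "0 < ?h" "?h < pi / real q" "?h < pi" using assms by (simp_all add: field_simps)
  then have "sin ?h > 0" by (intro sin_gt_zero) auto
  moreover have "dirichlet_kernel q ?h * sin ?h = 1"
    using assms by (simp add: dirichlet_kernel_mult_sin)
  ultimately have "1 / sin ?h = dirichlet_kernel q ?h" by (simp add: field_simps)
  also have "\<dots> \<le> dirichlet_kernel q x"
    using dirichlet_kernel_strict_antimono[of q x ?h] assms \<open>?h < pi / real q\<close>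
    by (cases "x = ?h") auto
  finally show ?thesis .
qed

lemma dirichlet_kernel_gt_1:
  assumes "q \<ge> 2" "0 \<le> x" "x \<le> pi / (2 * real q)"
  shows "dirichlet_kernel q x > 1"
proof -
  let ?h = "pi / (2 * real q)"
  have h: "0 < ?h" "?h < pi / 2" using assms by (simp_all add: field_simps)
  then have "0 < sin ?h" "sin ?h < 1"
    using sin_monotone_2pi[of ?h "pi / 2"] by (auto intro!: sin_gt_zero)
  then have "1 < 1 / sin ?h" by simp
  with inverse_sin_le_dirichlet_kernel[OF assms] show ?thesis by simp
qed

text \<open>Up to \<open>pi / q\<close> the kernel is nonnegative and decreasing. From there to
  \<open>pi / 2\<close> it is at most \<open>1 / sin y\<close> in absolute value, which is below the
  lower bound at \<open>x\<close>. Reflection covers the rest.\<close>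

lemma abs_dirichlet_kernel_less:
  assumes "q \<ge> 2" "0 \<le> x" "x \<le> pi / (2 * real q)" "x < y" "y < pi - x"
  shows "\<bar>dirichlet_kernel q y\<bar> < dirichlet_kernel q x"
proof -
  have *: "\<bar>dirichlet_kernel q y\<bar> < dirichlet_kernel q x" if y: "x < y" "y \<le> pi / 2" for y
  proof (cases "y \<le> pi / real q")
    case True
    have "0 < pi / real q" "pi / real q < pi" using assms by (simp_all add: field_simps)
    then have "sin (pi / real q) > 0" by (intro sin_gt_zero) auto
    then have "dirichlet_kernel q (pi / real q) = 0"
      using dirichlet_kernel_mult_sin[of q "pi / real q"] assms by simp
    then have "dirichlet_kernel q y \<ge> 0"
      using dirichlet_kernel_strict_antimono[of q y "pi / real q"] assms y True
      by (cases "y = pi / real q") auto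
    then show ?thesis
      using dirichlet_kernel_strict_antimono[of q x y] assms y True by simp
  next
    case False
    let ?h = "pi / (2 * real q)"
    have h: "0 < ?h" "?h < pi / real q" using assms by (simp_all add: field_simps)
    then have "?h < pi / 2" "?h < y" using False y by linarith+
    then have "sin ?h > 0" "sin ?h < sin y"
      using h y by (auto intro!: sin_gt_zero sin_monotone_2pi)
    have "\<bar>dirichlet_kernel q y\<bar> * sin y = \<bar>sin (real q * y)\<bar>"
      using \<open>sin ?h > 0\<close> \<open>sin ?h < sin y\<close>
      by (simp flip: dirichlet_kernel_mult_sin add: abs_mult)
    also have "\<dots> \<le> 1" by simp
    finally have "\<bar>dirichlet_kernel q y\<bar> \<le> 1 / sin y"
      using \<open>sin ?h > 0\<close> \<open>sin ?h < sin y\<close> by (simp add: field_simps)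
    also have "\<dots> < 1 / sin ?h"
      using \<open>sin ?h > 0\<close> \<open>sin ?h < sin y\<close> by (simp add: frac_less2)
    also have "\<dots> \<le> dirichlet_kernel q x"
      using assms by (intro inverse_sin_le_dirichlet_kernel)
    finally show ?thesis .
  qed
  show ?thesis
  proof (cases "y \<le> pi / 2")
    case False
    then show ?thesis
      using *[of "pi - y"] assms by (simp add: abs_dirichlet_kernel_reflect)
  qed (use * assms in auto)
qed

section \<open>The dominant frequency\<close>

context
  fixes q d b :: nat
  assumes q: "q \<ge> 2" and d: "d \<ge> 2"
begin

private definition "m = d * q"
text \<open>At the frequency \<open>l = 1\<close>, \<open>\<rho>\<close> is the growth factor per
  digit and \<open>\<phi> k\<close> the phase after \<open>k\<close> digits.\<close>

private definition "\<rho> = dirichlet_kernel q (pi / real m)"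
private definition "\<phi> k = (real k * (real q - 1) - 2 * real b) * (pi / real m)"
private definition
  "err k = real (card {n. n < q ^ k \<and> [digit_sum q n = b] (mod m)}) - real (q ^ k) / real m"

private lemma m: "m \<ge> 4" "pi / real m \<le> pi / (2 * real q)"
proof -
  have "2 * 2 \<le> d * q" using q d by (intro mult_le_mono)
  then show "m \<ge> 4" by (simp add: m_def)
  have "2 * real q \<le> real m" using d q by (simp add: m_def)
  then show "pi / real m \<le> pi / (2 * real q)"
    using q by (intro divide_left_mono) (auto simp: m_def)
qed

private lemma \<rho>_gt_1: "\<rho> > 1"
  unfolding \<rho>_def using q m by (intro dirichlet_kernel_gt_1) auto

private lemma err_eq_sum:
  "err k = (\<Sum>l=1..<m. digit_sum_mode q b k (pi * real l / real m)) / real m"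
proof -
  have "real m * real (card {n. n < q ^ k \<and> [digit_sum q n = b] (mod m)}) =
        real q ^ k + (\<Sum>l=1..<m. digit_sum_mode q b k (pi * real l / real m))"
    using m q by (simp add: card_digit_sum_cong lessThan_atLeast0 sum.atLeast_Suc_lessThan
        digit_sum_mode_0)
  then show ?thesis
    using m unfolding err_def by (simp add: field_simps)
qed

text \<open>Every frequency strictly between the first and the last has a kernel smaller than
  \<open>\<rho>\<close> in absolute value, so its normalised term decays geometrically.\<close>

private lemma mode_tendsto:
  assumes l: "l \<in> {1..<m}" and k: "strict_mono k" and \<phi>: "\<And>t. cos (\<phi> (k t)) = c"
  shows "(\<lambda>t. digit_sum_mode q b (k t) (pi * real l / real m) / \<rho> ^ k t)
           \<longlonglongrightarrow> (if l = 1 \<or> l = m - 1 then c else 0)"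
proof -
  consider "l = 1 \<or> l = m - 1" | "1 < l" "l < m - 1" using l by fastforce
  then show ?thesis
  proof cases
    case 1
    have first: "digit_sum_mode q b (k t) (pi / real m) / \<rho> ^ k t = c" for t
      using \<rho>_gt_1 \<phi>[of t] by (simp add: digit_sum_mode_eq \<rho>_def \<phi>_def)
    have "pi * real (m - 1) / real m = pi - pi / real m"
      using m by (simp add: of_nat_diff field_simps)
    then have "digit_sum_mode q b (k t) (pi * real l / real m) = digit_sum_mode q b (k t) (pi / real m)"
      for t using 1 digit_sum_mode_reflect by auto
    then show ?thesis using 1 first by simp
  next
    case 2
    define r where "r = dirichlet_kernel q (pi * real l / real m) / \<rho>"
    have "pi / real m < pi * real l / real m" using 2 m by (simp add: field_simps)
    moreover have "real l < real m - 1" using 2 by linarith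
    then have "pi * real l / real m < pi * (real m - 1) / real m"
      using m by (intro divide_strict_right_mono mult_strict_left_mono) auto
    then have "pi * real l / real m < pi - pi / real m"
      using m by (simp add: field_simps)
    ultimately have "\<bar>dirichlet_kernel q (pi * real l / real m)\<bar> < \<rho>"
      unfolding \<rho>_def using q m by (intro abs_dirichlet_kernel_less) auto
    then have "norm r < 1" using \<rho>_gt_1 by (simp add: r_def field_simps)
    then have "(\<lambda>t. \<bar>r\<bar> ^ k t) \<longlonglongrightarrow> 0"
      using k LIMSEQ_subseq_LIMSEQ[OF LIMSEQ_power_zero[of "\<bar>r\<bar>"] k] by (simp add: o_def)
    moreover have "\<bar>digit_sum_mode q b (k t) (pi * real l / real m) / \<rho> ^ k t\<bar> \<le> \<bar>r\<bar> ^ k t" for t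
    proof -
      have "digit_sum_mode q b (k t) (pi * real l / real m) / \<rho> ^ k t =
          r ^ k t * cos ((real (k t) * (real q - 1) - 2 * real b) * (pi * real l / real m))"
        by (simp add: digit_sum_mode_eq r_def power_divide)
      then show ?thesis by (simp add: abs_mult power_abs mult_left_le)
    qed
    ultimately have "(\<lambda>t. digit_sum_mode q b (k t) (pi * real l / real m) / \<rho> ^ k t) \<longlonglongrightarrow> 0"
      by (elim tendsto_0_le[where K = 1]) simp
    then show ?thesis using 2 by simp
  qed
qed

private lemma err_tendsto:
  assumes k: "strict_mono k" and \<phi>: "\<And>t. cos (\<phi> (k t)) = c"
  shows "(\<lambda>t. err (k t) / \<rho> ^ k t) \<longlonglongrightarrow> 2 * c / real m"
proof -
  have "(\<lambda>t. (\<Sum>l=1..<m. digit_sum_mode q b (k t) (pi * real l / real m) / \<rho> ^ k t) / real m)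
     \<longlonglongrightarrow> (\<Sum>l=1..<m. if l = 1 \<or> l = m - 1 then c else 0) / real m"
    using m by (intro tendsto_divide tendsto_sum mode_tendsto assms tendsto_const) auto
  moreover have "(\<Sum>l=1..<m. if l = 1 \<or> l = m - 1 then c else 0) = 2 * c"
  proof -
    \<comment> \<open>The factor 2 counts the two dominant frequencies, distinct because
      \<open>m\<close> is at least 4.\<close>
    have "{1..<m} \<inter> {l. l = 1 \<or> l = m - 1} = {1, m - 1}" "1 \<noteq> m - 1" using m by auto
    then show ?thesis by (simp add: sum.If_cases)
  qed
  moreover have "err (k t) / \<rho> ^ k t =
      (\<Sum>l=1..<m. digit_sum_mode q b (k t) (pi * real l / real m) / \<rho> ^ k t) / real m" for t
    by (simp add: err_eq_sum sum_divide_distrib mult.commute)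
  ultimately show ?thesis by simp
qed

text \<open>From \<open>d\<close> at least 2, the step is at most
  \<open>(q - 1) * pi / (2 * q)\<close>.\<close>

private lemma phase_step: "0 < (real q - 1) * (pi / real m)" "(real q - 1) * (pi / real m) < pi / 2"
proof -
  show "0 < (real q - 1) * (pi / real m)" using m q by simp
  have "(real q - 1) * (pi / real m) \<le> (real q - 1) * (pi / (2 * real q))"
    using m(2) q by (intro mult_left_mono) auto
  also have "\<dots> < pi / 2" using q by (simp add: field_simps)
  finally show "(real q - 1) * (pi / real m) < pi / 2" .
qed

text \<open>Successive phases differ by less than a quarter turn, so no quadrant is skipped.\<close>

private lemma obtain_phase:
  assumes "y \<ge> 0"
  obtains k where "y \<le> \<phi> k" "\<phi> k < y + pi / 2"
proof -
  define \<alpha> \<beta> where "\<alpha> = (real q - 1) * (pi / real m)" and "\<beta> = 2 * real b * (pi / real m)"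
  have \<alpha>: "0 < \<alpha>" "\<alpha> < pi / 2" using phase_step by (simp_all add: \<alpha>_def)
  have "\<beta> \<ge> 0" by (simp add: \<beta>_def)
  \<comment> \<open>The first index whose phase reaches \<open>y\<close>; it overshoots by less than
    one step \<open>\<alpha>\<close>.\<close>
  define k where "k = nat \<lceil>(y + \<beta>) / \<alpha>\<rceil>"
  have "(y + \<beta>) / \<alpha> \<ge> 0" using \<alpha> assms \<open>\<beta> \<ge> 0\<close> by simp
  then have "(y + \<beta>) / \<alpha> \<le> real k" "real k < (y + \<beta>) / \<alpha> + 1"
    unfolding k_def by linarith+
  then have "y + \<beta> \<le> real k * \<alpha>" "real k * \<alpha> < y + \<beta> + \<alpha>"
    using \<alpha> by (simp_all add: field_simps)
  moreover have "\<phi> k = real k * \<alpha> - \<beta>"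
    by (simp add: \<phi>_def \<alpha>_def \<beta>_def algebra_simps diff_divide_distrib)
  ultimately show ?thesis using \<alpha> that[of k] by simp
qed

text \<open>The shift adds \<open>t * (q - 1)\<close> full turns, giving a progression of exponents
  with constant cosine.\<close>

private lemma cos_phase_periodic: "cos (\<phi> (k + 2 * m * t)) = cos (\<phi> k)"
proof -
  have "real (q - 1) = real q - 1" using q by (simp add: of_nat_diff)
  then have "\<phi> (k + 2 * m * t) = \<phi> k + 2 * real (t * (q - 1)) * pi"
    using m by (simp add: \<phi>_def field_simps)
  then show ?thesis by (simp add: cos_add del: of_nat_mult)
qed

lemma digit_sum_cong_excess_unbounded:
  obtains k k' :: "nat \<Rightarrow> nat" where
    "strict_mono k" "strict_mono k'"
    "filterlim (\<lambda>t. real (card {n. n < q ^ k t \<and> [digit_sum q n = b] (mod (d * q))})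
        - real (q ^ k t) / (real d * real q)) at_top sequentially"
    "filterlim (\<lambda>t. real (card {n. n < q ^ k' t \<and> [digit_sum q n = b] (mod (d * q))})
        - real (q ^ k' t) / (real d * real q)) at_bot sequentially"
proof -
  \<comment> \<open>Phases in the first quadrant give a positive limit, those in the third a
    negative one.\<close>
  obtain k0 where "0 \<le> \<phi> k0" "\<phi> k0 < pi / 2" using obtain_phase[of 0] by auto
  then have pos: "cos (\<phi> k0) > 0" by (intro cos_gt_zero_pi) auto
  obtain k1 where k1: "pi \<le> \<phi> k1" "\<phi> k1 < pi + pi / 2" using obtain_phase[of pi] by auto
  then have "cos (\<phi> k1 - pi) > 0" by (intro cos_gt_zero_pi) auto
  then have neg: "cos (\<phi> k1) < 0" by (simp add: cos_diff)
  have mono: "strict_mono (\<lambda>t. k + 2 * m * t)" for k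
    using m by (intro strict_monoI) auto
  have lim: "(\<lambda>t. err (k + 2 * m * t) / \<rho> ^ (k + 2 * m * t)) \<longlonglongrightarrow> 2 * cos (\<phi> k) / real m" for k
    by (intro err_tendsto mono cos_phase_periodic)
  have top: "filterlim (\<lambda>t. \<rho> ^ (k + 2 * m * t)) at_top sequentially" for k
  proof -
    have "filterlim (\<lambda>n. norm (\<rho> ^ n)) at_top sequentially"
      using \<rho>_gt_1 by (intro filterlim_at_infinity_imp_norm_at_top filterlim_realpow_sequentially_gt1) simp
    then show ?thesis
      using \<rho>_gt_1 filterlim_compose[OF _ filterlim_subseq[OF mono]] by (simp add: norm_power)
  qed
  have eq: "err (k + 2 * m * t) / \<rho> ^ (k + 2 * m * t) * \<rho> ^ (k + 2 * m * t) = err (k + 2 * m * t)"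
    for k t using \<rho>_gt_1 by simp
  have "filterlim (\<lambda>t. err (k0 + 2 * m * t)) at_top sequentially"
    using filterlim_tendsto_pos_mult_at_top[OF lim[of k0] _ top[of k0]] pos m by (simp only: eq) simp
  moreover have "filterlim (\<lambda>t. err (k1 + 2 * m * t)) at_bot sequentially"
    using filterlim_tendsto_neg_mult_at_bot[OF lim[of k1] _ top[of k1]] neg m
    by (simp only: eq) (simp add: divide_neg_pos)
  ultimately show ?thesis
    using mono[of k0] mono[of k1] that unfolding err_def m_def of_nat_mult by blast
qed

end

section \<open>Assembly of both cases, with the Chinese remainder theorem for the second\<close>

theorem theorem2:
  fixes q d a j :: nat
  assumes "q \<ge> 2" and "d \<ge> 2" and "a < d" and "j < q"
  shows "(d dvd q \<longrightarrow>
            (\<exists>C. \<forall>N\<ge>1. \<bar>discrepancy q d a j N\<bar> \<le> C) \<and>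
            infinite {N. N \<ge> 1 \<and> discrepancy q d a j N > 0} \<and>
            infinite {N. N \<ge> 1 \<and> discrepancy q d a j N < 0}) \<and>
         (d dvd (q - 1) \<longrightarrow>
            limsup (\<lambda>N. ereal (discrepancy q d a j N)) = \<infinity> \<and>
            liminf (\<lambda>N. ereal (discrepancy q d a j N)) = -\<infinity>)"
proof (intro conjI impI)
  assume "d dvd q"
  then show "\<exists>C. \<forall>N\<ge>1. \<bar>discrepancy q d a j N\<bar> \<le> C"
    and "infinite {N. N \<ge> 1 \<and> discrepancy q d a j N > 0}"
    and "infinite {N. N \<ge> 1 \<and> discrepancy q d a j N < 0}"
    using assms discrepancy_bounded[of q d] infinite_discrepancy_sign[of q d] by auto
next
  assume dvd: "d dvd q - 1"
  have "coprime d q"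
    using dvd assms by (metis coprime_diff_one_left_nat coprime_divisors dvd_refl
        gr0I not_numeral_le_zero)
  obtain b where b: "[b = a] (mod d)" "[b = j] (mod q)"
    using binary_chinese_remainder_nat[OF \<open>coprime d q\<close>] by blast
  \<comment> \<open>Modulo \<open>d\<close>, \<open>n\<close> may be replaced by its digit sum, so
    both conditions merge into one modulo \<open>d * q\<close>.\<close>
  have iff: "[n = a] (mod d) \<and> [digit_sum q n = j] (mod q) \<longleftrightarrow> [digit_sum q n = b] (mod (d * q))" for n
  proof -
    have "[digit_sum q n = b] (mod (d * q)) \<longleftrightarrow>
          [digit_sum q n = b] (mod d) \<and> [digit_sum q n = b] (mod q)"
      using \<open>coprime d q\<close> by (meson coprime_cong_mult_nat
          cong_dvd_modulus_nat dvd_triv_left dvd_triv_right)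
    then show ?thesis
      using b cong_digit_sum[OF assms(1) dvd, of n] by (auto simp: cong_def)
  qed
  obtain k k' :: "nat \<Rightarrow> nat" where k: "strict_mono k" "strict_mono k'"
    and top: "filterlim (\<lambda>t. discrepancy q d a j (q ^ k t)) at_top sequentially"
    and bot: "filterlim (\<lambda>t. discrepancy q d a j (q ^ k' t)) at_bot sequentially"
    using digit_sum_cong_excess_unbounded[OF assms(1,2), of b]
    unfolding discrepancy_def iff by blast
  have mono: "strict_mono (\<lambda>t. q ^ k t)" if "strict_mono k" for k :: "nat \<Rightarrow> nat"
    using that assms by (auto simp: strict_mono_def)
  let ?g = "\<lambda>N. ereal (discrepancy q d a j N)"
  \<comment> \<open>A subsequence's limsup bounds the full limsup from below; dually for
    liminf.\<close>
  have "(?g \<circ> (\<lambda>t. q ^ k t)) \<longlonglongrightarrow> \<infinity>"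
    using top by (simp add: o_def tendsto_PInfty_eq_at_top)
  then have "limsup (?g \<circ> (\<lambda>t. q ^ k t)) = \<infinity>"
    by (intro lim_imp_Limsup) simp_all
  then show "limsup ?g = \<infinity>"
    using limsup_subseq_mono[OF mono[OF k(1)], of ?g] by simp
  have "(?g \<circ> (\<lambda>t. q ^ k' t)) \<longlonglongrightarrow> -\<infinity>"
    using bot by (simp add: o_def tendsto_MInfty filterlim_at_bot_dense)
  then have "liminf (?g \<circ> (\<lambda>t. q ^ k' t)) = -\<infinity>"
    by (intro lim_imp_Liminf) simp_all
  then show "liminf ?g = -\<infinity>"
    using liminf_subseq_mono[OF mono[OF k(2)], of ?g] by simp
qed

end
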